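(* Let $\mathsf{X} \subseteq \{n \in \mathbb{N} : n>1\}$, let $\hat{\mathsf{X}}$ be its completion, and let $\Gamma$ be a nested sequent. If $\mathsf{nK} + \Diamond_{\mathsf{k}\hat{\mathsf{X}}} + \mathsf{cut} \vdash \Gamma$, then $\mathsf{nK} + \Diamond_{\mathsf{k}\hat{\mathsf{X}}} \vdash \Gamma$.
   Context: Formulas. Let $\mathsf{Atm}$ be a countable set of propositional variables. Formulas are in negation normal form: $A ::= p \mid \bar p \mid (A \wedge A) \mid (A \vee A) \mid \Box A \mid \Diamond A$ with $p \in \mathsf{Atm}$. The negation $\bar A$ is defined by de Morgan duality ($\bar{\bar p} = p$, $\wedge/\vee$ dual, $\Box/\Diamond$ dual). Nested sequents. A nested sequent is a finite (possibly empty) multiset of formulas and boxed sequents $[\Gamma]$, where $\Gamma$ is a nested sequent; comma is multiset union and $\varnothing$ is the empty sequent. A context $\Gamma\{\ \}$ is a nested sequent with a hole in place of a formula (the hole is not inside a formula, but may be inside nested brackets); $\Gamma\{\Gamma_1\}$ is the result of replacing the hole by the sequent $\Gamma_1$. Rules (premises / conclusion), for arbitrary contexts $\Gamma\{\ \}$, formulas $A,B$, variables $p$ and nested sequents $\Delta,\Delta_i$. System $\mathsf{nK}$ consists of: - $\mathsf{id}$: no premise / $\Gamma\{p,\bar p\}$; - $\vee$: $\Gamma\{A,B\}$ / $\Gamma\{A\vee B\}$; - $\wedge$: $\Gamma\{A\}$ and $\Gamma\{B\}$ / $\Gamma\{A\wedge B\}$; - $\Box$: $\Gamma\{[A]\}$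 / $\Gamma\{\Box A\}$; - $\Diamond$: $\Gamma\{\Diamond A,[A,\Delta]\}$ / $\Gamma\{\Diamond A,[\Delta]\}$. Further rules: - $\mathsf{cut}$: $\Gamma\{A\}$ and $\Gamma\{\bar A\}$ / $\Gamma\{\varnothing\}$; - $\Diamond_{\mathsf{k}n}$ ($n\ge 1$): $\Gamma\{\Diamond A,[\Delta_1,[\dots,[\Delta_{n-1},[A,\Delta_n]]\dots]]\}$ / $\Gamma\{\Diamond A,[\Delta_1,[\dots,[\Delta_{n-1},[\Delta_n]]\dots]]\}$. For $\mathsf{Y}\subseteq\{n\in\mathbb{N}: n>1\}$, $\Diamond_{\mathsf{k}\mathsf{Y}} := \{\Diamond_{\mathsf{k}n} : n\in \mathsf{Y}\}$. A proof in a system is a finite tree of nested sequents built by its rules with leaves instances of $\mathsf{id}$; $\mathsf{N}\vdash\Gamma$ means there is a proof in $\mathsf{N}$ with root $\Gamma$. Completion. For $\mathsf{X}\subseteq\{n\in\mathbb{N}: n>1\}$, put $\mathsf{X}_0 := \mathsf{X}$, $\mathsf{X}_{p+1} := \mathsf{X}_p\cup\{m+n-1 : m,n\in\mathsf{X}_p\}$, and $\hat{\mathsf{X}} := \bigcup_{p=0}^\infty \mathsf{X}_p$. *)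

theory Defs
  imports "HOL-Library.Multiset" "HOL-Library.Countable"
begin

datatype 'a fm =
    Pos 'a
  | Neg 'a
  | And "'a fm" "'a fm"
  | Or "'a fm" "'a fm"
  | Box "'a fm"
  | Dia "'a fm"

primrec dual :: "'a fm \<Rightarrow> 'a fm" where
  "dual (Pos p) = Neg p"
| "dual (Neg p) = Pos p"
| "dual (And A B) = Or (dual A) (dual B)"
| "dual (Or A B) = And (dual A) (dual B)"
| "dual (Box A) = Dia (dual A)"
| "dual (Dia A) = Box (dual A)"

datatype 'a item =
    Fm "'a fm"
  | Bracket "'a item multiset"

type_synonym 'a nseq = "'a item multiset"

text \<open>
  A context is given by the path from the root to its unique hole: \<open>Hole \<Delta>\<close> is the context
  consisting of \<open>\<Delta>\<close> and a hole at the top level, and \<open>Inside \<Delta> C\<close> consists of \<open>\<Delta>\<close> and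
  a bracket whose content is the context \<open>C\<close>.
\<close>

datatype 'a ctx =
    Hole "'a nseq"
  | Inside "'a nseq" "'a ctx"

primrec fill :: "'a ctx \<Rightarrow> 'a nseq \<Rightarrow> 'a nseq" where
  "fill (Hole \<Delta>) \<Gamma> = \<Delta> + \<Gamma>"
| "fill (Inside \<Delta> C) \<Gamma> = \<Delta> + {#Bracket (fill C \<Gamma>)#}"

text \<open>
  A rule is the set of its instances, each a list of premises paired with a conclusion;
  a system is a set of instances, so systems are combined by union.
\<close>

type_synonym 'a rule = "('a nseq list \<times> 'a nseq) set"

definition id_rule :: "'a rule" where
  "id_rule = {([], fill C {#Fm (Pos p), Fm (Neg p)#}) | C p. True}"

definition or_rule :: "'a rule" where
  "or_rule = {([fill C {#Fm A, Fm B#}], fill C {#Fm (Or A B)#}) | C A B. True}"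

definition and_rule :: "'a rule" where
  "and_rule = {([fill C {#Fm A#}, fill C {#Fm B#}], fill C {#Fm (And A B)#}) | C A B. True}"

definition box_rule :: "'a rule" where
  "box_rule = {([fill C {#Bracket {#Fm A#}#}], fill C {#Fm (Box A)#}) | C A. True}"

definition dia_rule :: "'a rule" where
  "dia_rule =
    {([fill C {#Fm (Dia A), Bracket ({#Fm A#} + \<Delta>)#}],
      fill C {#Fm (Dia A), Bracket \<Delta>#}) | C A \<Delta>. True}"

definition nK :: "'a rule" where
  "nK = id_rule \<union> or_rule \<union> and_rule \<union> box_rule \<union> dia_rule"

definition cut_rule :: "'a rule" where
  "cut_rule = {([fill C {#Fm A#}, fill C {#Fm (dual A)#}], fill C {#}) | C A. True}"

text \<open>
  For \<open>n \<ge> 1\<close>, \<open>nest [\<Delta>\<^sub>1, \<dots>, \<Delta>\<^sub>n] \<Gamma>\<close> is the sequent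
  \<open>[\<Delta>\<^sub>1, [\<Delta>\<^sub>2, [\<dots>, [\<Delta>\<^sub>n, \<Gamma>] \<dots>]]]\<close>, where the brackets
  are those of nested sequents.
\<close>

primrec nest :: "'a nseq list \<Rightarrow> 'a nseq \<Rightarrow> 'a nseq" where
  "nest [] \<Gamma> = \<Gamma>"
| "nest (\<Delta> # \<Delta>s) \<Gamma> = {#Bracket (\<Delta> + nest \<Delta>s \<Gamma>)#}"

definition dia_k_rule :: "nat \<Rightarrow> 'a rule" where
  "dia_k_rule n =
    {([fill C ({#Fm (Dia A)#} + nest \<Delta>s {#Fm A#})],
      fill C ({#Fm (Dia A)#} + nest \<Delta>s {#})) | C A \<Delta>s. length \<Delta>s = n \<and> n \<ge> 1}"

definition dia_k_rules :: "nat set \<Rightarrow> 'a rule" where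
  "dia_k_rules Y = (\<Union>n\<in>Y. dia_k_rule n)"

inductive provable :: "'a rule \<Rightarrow> 'a nseq \<Rightarrow> bool" (infix "\<turnstile>" 50) for N where
  step: "(\<Gamma>s, \<Gamma>) \<in> N \<Longrightarrow> (\<And>\<Delta>. \<Delta> \<in> set \<Gamma>s \<Longrightarrow> N \<turnstile> \<Delta>) \<Longrightarrow> N \<turnstile> \<Gamma>"

text \<open>Only used for sets of numbers greater than 1, where \<open>m + n - 1\<close> does not truncate.\<close>

primrec completion_stage :: "nat set \<Rightarrow> nat \<Rightarrow> nat set" where
  "completion_stage X 0 = X"
| "completion_stage X (Suc p) =
    completion_stage X p \<union>
    {m + n - 1 | m n. m \<in> completion_stage X p \<and> n \<in> completion_stage X p}"

definition completion :: "nat set \<Rightarrow> nat set" where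
  "completion X = (\<Union>p. completion_stage X p)"

end

theory Submission
  imports Defs
begin

text \<open>
  The proof is semantic. All rules, including cut, are sound for Kripke models in which
  \<open>R\<^sup>n \<subseteq> R\<close> for all \<open>n\<close> in the completion. Conversely, starting from a sequent without a cut-free
  proof, apply the rules upwards forever and fairly, always moving to an unprovable premise. The
  limit is an infinite tree whose formulas are all falsified when \<open>w R v\<close> is read as ``\<open>v\<close> is a
  descendant of \<open>w\<close> at distance \<open>1\<close> or in the completion''. This relation has the required closure
  property because the completion is closed under \<open>(m, n) \<mapsto> m + n - 1\<close>. As the rules are only used
  as they stand, neither contraction nor weakening has to be shown admissible.
\<close>

instance fm :: (countable) countable
  by countable_datatype

section \<open>Soundness\<close>

primrec sat :: "('w \<Rightarrow> 'w \<Rightarrow> bool) \<Rightarrow> ('w \<Rightarrow> 'a \<Rightarrow> bool) \<Rightarrow> 'w \<Rightarrow> 'a fm \<Rightarrow> bool" where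
  "sat R V w (Pos p) \<longleftrightarrow> V w p"
| "sat R V w (Neg p) \<longleftrightarrow> \<not> V w p"
| "sat R V w (And A B) \<longleftrightarrow> sat R V w A \<and> sat R V w B"
| "sat R V w (Or A B) \<longleftrightarrow> sat R V w A \<or> sat R V w B"
| "sat R V w (Box A) \<longleftrightarrow> (\<forall>v. R w v \<longrightarrow> sat R V v A)"
| "sat R V w (Dia A) \<longleftrightarrow> (\<exists>v. R w v \<and> sat R V v A)"

lemma sat_dual: "sat R V w (dual A) \<longleftrightarrow> \<not> sat R V w A"
  by (induction A arbitrary: w) auto

text \<open>The negation of the usual reading of a sequent, where the comma is disjunction and a
  bracket is a box. An inductive predicate avoids recursion through multisets; as sequents are
  finite trees, \<open>falsified_iff\<close> determines it.\<close>

inductive falsified :: "('w \<Rightarrow> 'w \<Rightarrow> bool) \<Rightarrow> ('w \<Rightarrow> 'a \<Rightarrow> bool) \<Rightarrow> 'w \<Rightarrow> 'a nseq \<Rightarrow> bool"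
  for R V where
  falsifiedI: "(\<forall>A. Fm A \<in># \<Gamma> \<longrightarrow> \<not> sat R V w A) \<Longrightarrow>
    (\<forall>\<Delta>. Bracket \<Delta> \<in># \<Gamma> \<longrightarrow> (\<exists>v. R w v \<and> falsified R V v \<Delta>)) \<Longrightarrow> falsified R V w \<Gamma>"

lemma falsified_iff:
  "falsified R V w \<Gamma> \<longleftrightarrow> (\<forall>A. Fm A \<in># \<Gamma> \<longrightarrow> \<not> sat R V w A) \<and>
    (\<forall>\<Delta>. Bracket \<Delta> \<in># \<Gamma> \<longrightarrow> (\<exists>v. R w v \<and> falsified R V v \<Delta>))"
  by (subst falsified.simps) blast

lemma falsified_empty [simp]: "falsified R V w {#}"
  by (subst falsified_iff) simp

lemma falsified_union [simp]:
  "falsified R V w (\<Gamma> + \<Delta>) \<longleftrightarrow> falsified R V w \<Gamma> \<and> falsified R V w \<Delta>"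
  by (subst (1 2 3) falsified_iff) auto

lemma falsified_Fm [simp]:
  "falsified R V w (add_mset (Fm A) \<Gamma>) \<longleftrightarrow> \<not> sat R V w A \<and> falsified R V w \<Gamma>"
  by (subst (1 2) falsified_iff) auto

lemma falsified_Bracket [simp]:
  "falsified R V w (add_mset (Bracket \<Delta>) \<Gamma>) \<longleftrightarrow>
    (\<exists>v. R w v \<and> falsified R V v \<Delta>) \<and> falsified R V w \<Gamma>"
  by (subst (1 3) falsified_iff) auto

text \<open>\<open>S\<close> holds the alternatives offered by the premises of a rule: none for an
  axiom, two for \<open>and_rule\<close> and \<open>cut_rule\<close>. The brackets around the hole
  fix a world at which its content is read, and the alternative chosen there serves for the whole
  sequent.\<close>

lemma falsified_fill:
  assumes "falsified R V w (fill C \<Gamma>)"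
    and "\<And>v. falsified R V v \<Gamma> \<Longrightarrow> \<exists>\<Delta>\<in>S. falsified R V v \<Delta>"
  shows "\<exists>\<Delta>\<in>S. falsified R V w (fill C \<Delta>)"
  using assms(1)
proof (induction C arbitrary: w)
  case (Hole \<Theta>)
  then show ?case using assms(2) by auto
next
  case (Inside \<Theta> C)
  then show ?case by fastforce
qed

text \<open>The worlds witnessing the brackets are chosen once, for the empty filling; the last of
  them is \<open>v\<close>. Refilling the innermost bracket leaves these choices intact, so
  \<open>v\<close> is uniform in \<open>\<Gamma>\<close>.\<close>

lemma falsified_nest:
  assumes "falsified R V w (nest \<Delta>s {#})"
  shows "\<exists>v. (R ^^ length \<Delta>s) w v \<and> (\<forall>\<Gamma>. falsified R V v \<Gamma> \<longrightarrow> falsified R V w (nest \<Delta>s \<Gamma>))"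
  using assms
proof (induction \<Delta>s arbitrary: w)
  case Nil
  then show ?case by auto
next
  case (Cons \<Delta> \<Delta>s)
  then obtain u where u: "R w u" "falsified R V u \<Delta>" "falsified R V u (nest \<Delta>s {#})"
    by auto
  with Cons.IH obtain v where v: "(R ^^ length \<Delta>s) u v"
    "\<forall>\<Gamma>. falsified R V v \<Gamma> \<longrightarrow> falsified R V u (nest \<Delta>s \<Gamma>)" by blast
  have "(R ^^ length (\<Delta> # \<Delta>s)) w v" using relpowp_Suc_I2[OF u(1) v(1)] by simp
  moreover have "falsified R V w (nest (\<Delta> # \<Delta>s) \<Gamma>)" if "falsified R V v \<Gamma>" for \<Gamma>
    using u(1,2) v(2) that by auto
  ultimately show ?case by blast
qed

text \<open>A world falsifying a conclusion also falsifies one of the premises, which is impossible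
  all the way up a finite proof. For cut, one of the two alternatives always holds by
  \<open>sat_dual\<close>.\<close>

lemma soundness:
  fixes R :: "'w \<Rightarrow> 'w \<Rightarrow> bool" and V :: "'w \<Rightarrow> 'a \<Rightarrow> bool"
  assumes "nK \<union> dia_k_rules Y \<union> cut_rule \<turnstile> \<Gamma>"
    and closed: "\<And>n w v. n \<in> Y \<Longrightarrow> (R ^^ n) w v \<Longrightarrow> R w v"
  shows "\<not> falsified R V w \<Gamma>"
  using assms(1)
proof (induction arbitrary: w)
  case (step \<Gamma>s \<Gamma>)
  show ?case
  proof
    assume fals: "falsified R V w \<Gamma>"
    have red: "\<exists>\<Delta>\<in>S. falsified R V w (fill C \<Delta>)"
      if "\<Gamma> = fill C \<Theta>" "\<forall>v. falsified R V v \<Theta> \<longrightarrow> (\<exists>\<Delta>\<in>S. falsified R V v \<Delta>)" for C \<Theta> S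
      using falsified_fill[of R V w C \<Theta> S] fals that by blast
    from step.hyps(1) consider
        (id) "(\<Gamma>s, \<Gamma>) \<in> id_rule" | (or) "(\<Gamma>s, \<Gamma>) \<in> or_rule" | (conj) "(\<Gamma>s, \<Gamma>) \<in> and_rule"
      | (box) "(\<Gamma>s, \<Gamma>) \<in> box_rule" | (dia) "(\<Gamma>s, \<Gamma>) \<in> dia_rule"
      | (diak) n where "n \<in> Y" "(\<Gamma>s, \<Gamma>) \<in> dia_k_rule n" | (cut) "(\<Gamma>s, \<Gamma>) \<in> cut_rule"
      by (auto simp: nK_def dia_k_rules_def)
    then have "\<exists>\<Delta>\<in>set \<Gamma>s. falsified R V w \<Delta>"
    proof cases
      case id
      then obtain C p where "\<Gamma> = fill C {#Fm (Pos p), Fm (Neg p)#}" by (auto simp: id_rule_def)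
      \<comment> \<open>Two dual literals are never both false, so the empty set of alternatives is
        admissible and gives a contradiction.\<close>
      then have "\<exists>\<Delta>\<in>{}. falsified R V w (fill C \<Delta>)" by (rule red) auto
      then show ?thesis by simp
    next
      case or
      then obtain C A B where eq: "\<Gamma> = fill C {#Fm (Or A B)#}" "\<Gamma>s = [fill C {#Fm A, Fm B#}]"
        by (auto simp: or_rule_def)
      have "\<forall>v. falsified R V v {#Fm (Or A B)#} \<longrightarrow>
        (\<exists>\<Delta>\<in>{{#Fm A, Fm B#}}. falsified R V v \<Delta>)"
        by auto
      from red[OF eq(1) this] show ?thesis by (simp add: eq(2))
    next
      case conj
      then obtain C A B where eq: "\<Gamma> = fill C {#Fm (And A B)#}"
        "\<Gamma>s = [fill C {#Fm A#}, fill C {#Fm B#}]"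
        by (auto simp: and_rule_def)
      have "\<forall>v. falsified R V v {#Fm (And A B)#} \<longrightarrow>
        (\<exists>\<Delta>\<in>{{#Fm A#}, {#Fm B#}}. falsified R V v \<Delta>)"
        by auto
      from red[OF eq(1) this] show ?thesis by (simp add: eq(2))
    next
      case box
      then obtain C A where eq: "\<Gamma> = fill C {#Fm (Box A)#}" "\<Gamma>s = [fill C {#Bracket {#Fm A#}#}]"
        by (auto simp: box_rule_def)
      have "\<forall>v. falsified R V v {#Fm (Box A)#} \<longrightarrow>
        (\<exists>\<Delta>\<in>{{#Bracket {#Fm A#}#}}. falsified R V v \<Delta>)"
        by auto
      from red[OF eq(1) this] show ?thesis by (simp add: eq(2))
    next
      case dia
      then obtain C A \<Delta> where eq: "\<Gamma> = fill C {#Fm (Dia A), Bracket \<Delta>#}"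
        "\<Gamma>s = [fill C {#Fm (Dia A), Bracket ({#Fm A#} + \<Delta>)#}]"
        by (auto simp: dia_rule_def)
      have "\<forall>v. falsified R V v {#Fm (Dia A), Bracket \<Delta>#} \<longrightarrow>
        (\<exists>\<Theta>\<in>{{#Fm (Dia A), Bracket ({#Fm A#} + \<Delta>)#}}. falsified R V v \<Theta>)"
        by auto
      from red[OF eq(1) this] show ?thesis by (simp add: eq(2))
    next
      case (diak n)
      then obtain C A \<Delta>s where eq: "\<Gamma> = fill C ({#Fm (Dia A)#} + nest \<Delta>s {#})"
        "\<Gamma>s = [fill C ({#Fm (Dia A)#} + nest \<Delta>s {#Fm A#})]" and len: "length \<Delta>s = n"
        by (auto simp: dia_k_rule_def)
      have "\<exists>\<Delta>\<in>{{#Fm (Dia A)#} + nest \<Delta>s {#Fm A#}}. falsified R V v \<Delta>"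
        if v: "falsified R V v ({#Fm (Dia A)#} + nest \<Delta>s {#})" for v
      proof -
        obtain u where "(R ^^ length \<Delta>s) v u"
          and u: "\<And>\<Gamma>. falsified R V u \<Gamma> \<Longrightarrow> falsified R V v (nest \<Delta>s \<Gamma>)"
          using falsified_nest[of R V v \<Delta>s] v by auto
        \<comment> \<open>The frame condition contracts the path through the nested brackets to a
          single step, so the falsity of \<open>Dia A\<close> at \<open>v\<close> reaches
          \<open>u\<close>.\<close>
        then have "R v u" using closed diak(1) len by blast
        with v have "\<not> sat R V u A" by auto
        with v u[of "{#Fm A#}"] show ?thesis by simp
      qed
      then have "\<forall>v. falsified R V v ({#Fm (Dia A)#} + nest \<Delta>s {#}) \<longrightarrow>
        (\<exists>\<Delta>\<in>{{#Fm (Dia A)#} + nest \<Delta>s {#Fm A#}}. falsified R V v \<Delta>)" by blast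
      from red[OF eq(1) this] show ?thesis by (simp add: eq(2))
    next
      case cut
      then obtain C A where eq: "\<Gamma> = fill C {#}"
        "\<Gamma>s = [fill C {#Fm A#}, fill C {#Fm (dual A)#}]"
        by (auto simp: cut_rule_def)
      have "\<forall>v. falsified R V v {#} \<longrightarrow>
        (\<exists>\<Delta>\<in>{{#Fm A#}, {#Fm (dual A)#}}. falsified R V v \<Delta>)"
        by (auto simp: sat_dual)
      from red[OF eq(1) this] show ?thesis by (simp add: eq(2))
    qed
    with step.IH show False by blast
  qed
qed

section \<open>Trees with addressable nodes\<close>

text \<open>Children form a list rather than a multiset, so that every node has an address that
  stays the same during the search. This allows a limit to be taken node by node.\<close>

datatype 'a tree = Node (fms: "'a fm multiset") (kids: "'a tree list")

fun nseq_of :: "'a tree \<Rightarrow> 'a nseq" where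
  "nseq_of (Node \<Phi> ts) = image_mset Fm \<Phi> + mset (map (\<lambda>t. Bracket (nseq_of t)) ts)"

primrec valid :: "nat list \<Rightarrow> 'a tree \<Rightarrow> bool" where
  "valid [] t \<longleftrightarrow> True"
| "valid (i # w) t \<longleftrightarrow> i < length (kids t) \<and> valid w (kids t ! i)"

primrec subtree :: "nat list \<Rightarrow> 'a tree \<Rightarrow> 'a tree" where
  "subtree [] t = t"
| "subtree (i # w) t = subtree w (kids t ! i)"

primrec update :: "('a tree \<Rightarrow> 'a tree) \<Rightarrow> nat list \<Rightarrow> 'a tree \<Rightarrow> 'a tree" where
  "update g [] t = g t"
| "update g (i # w) t = Node (fms t) ((kids t)[i := update g w (kids t ! i)])"

definition add_fm :: "'a fm \<Rightarrow> 'a tree \<Rightarrow> 'a tree" where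
  "add_fm A t = Node (add_mset A (fms t)) (kids t)"

lemma ex_tree: "\<exists>t. nseq_of t = \<Gamma>"
proof -
  \<comment> \<open>One level only: trees for the bracketed sequents are assumed here and supplied
    below by induction on items.\<close>
  have ex: "\<exists>t. nseq_of t = \<Gamma>"
    if "\<And>\<Delta>. Bracket \<Delta> \<in># \<Gamma> \<Longrightarrow> \<exists>t. nseq_of t = \<Delta>" for \<Gamma> :: "'a nseq"
    using that
  proof (induction \<Gamma>)
    case empty
    have "nseq_of (Node {#} []) = ({#} :: 'a nseq)" by simp
    then show ?case by blast
  next
    case (add x \<Gamma>)
    have "\<exists>t. nseq_of t = \<Gamma>" by (rule add.IH, rule add.prems) simp
    then obtain \<Phi> ts where t: "nseq_of (Node \<Phi> ts) = \<Gamma>" by (metis tree.exhaust)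
    show ?case
    proof (cases x)
      case (Fm A)
      with t have "nseq_of (Node (add_mset A \<Phi>) ts) = add_mset x \<Gamma>" by simp
      then show ?thesis by blast
    next
      case (Bracket \<Delta>)
      have "\<exists>s. nseq_of s = \<Delta>" by (rule add.prems) (simp add: Bracket)
      then obtain s where "nseq_of s = \<Delta>" by blast
      with t Bracket have "nseq_of (Node \<Phi> (s # ts)) = add_mset x \<Gamma>" by simp
      then show ?thesis by blast
    qed
  qed
  have "\<forall>\<Delta>. x = Bracket \<Delta> \<longrightarrow> (\<exists>t. nseq_of t = \<Delta>)" for x :: "'a item"
  proof (induction x)
    case (Bracket \<Delta>)
    have "\<exists>t. nseq_of t = \<Delta>" by (rule ex) (use Bracket in blast)
    then show ?case by simp
  qed simp
  note brackets = this
  show ?thesis by (rule ex) (use brackets in blast)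
qed

section \<open>Contexts determined by addresses in a tree\<close>

lemma nseq_of_Node:
  "nseq_of t = image_mset Fm (fms t) + mset (map (\<lambda>s. Bracket (nseq_of s)) (kids t))"
  by (cases t) simp

lemma nseq_of_child:
  assumes "i < length ts"
  shows "nseq_of (Node \<Phi> (ts[i := s])) = image_mset Fm \<Phi> +
    (mset (map (\<lambda>s. Bracket (nseq_of s)) ts) - {#Bracket (nseq_of (ts ! i))#}) +
    {#Bracket (nseq_of s)#}"
  using assms by (simp add: map_update mset_update)

lemma update_id: "valid w t \<Longrightarrow> update (\<lambda>s. s) w t = t"
  by (induction w arbitrary: t) (auto simp: list_update_id)

text \<open>The context consists of everything outside the subtree at \<open>w\<close>, hence is the
  same for all \<open>g\<close>. The identity gives the sequent before a step, other choices the
  sequent after it.\<close>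

lemma ex_context_update:
  assumes "valid w t"
  shows "\<exists>C. \<forall>g. nseq_of (update g w t) = fill C (nseq_of (g (subtree w t)))"
  using assms
proof (induction w arbitrary: t)
  case Nil
  have "\<forall>g. nseq_of (update g [] t) = fill (Hole {#}) (nseq_of (g (subtree [] t)))" by simp
  then show ?case by blast
next
  case (Cons i w)
  then obtain C where
    C: "\<And>g. nseq_of (update g w (kids t ! i)) = fill C (nseq_of (g (subtree w (kids t ! i))))"
    by auto
  have "\<forall>g. nseq_of (update g (i # w) t) =
    fill (Inside (image_mset Fm (fms t) + (mset (map (\<lambda>s. Bracket (nseq_of s)) (kids t)) -
      {#Bracket (nseq_of (kids t ! i))#})) C) (nseq_of (g (subtree (i # w) t)))"
    using Cons.prems by (simp add: nseq_of_child C del: nseq_of.simps)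
  then show ?case by blast
qed

text \<open>Rules display only their active part; the other material next to the hole has to move
  into the context.\<close>

lemma ex_context_absorb: "\<exists>C'. \<forall>\<Gamma>. fill C (\<Delta> + \<Gamma>) = fill C' \<Gamma>"
proof (induction C)
  case (Hole \<Theta>)
  have "\<forall>\<Gamma>. fill (Hole \<Theta>) (\<Delta> + \<Gamma>) = fill (Hole (\<Theta> + \<Delta>)) \<Gamma>" by simp
  then show ?case by blast
next
  case (Inside \<Theta> C)
  then obtain C' where "\<forall>\<Gamma>. fill C (\<Delta> + \<Gamma>) = fill C' \<Gamma>" by blast
  then have "\<forall>\<Gamma>. fill (Inside \<Theta> C) (\<Delta> + \<Gamma>) = fill (Inside \<Theta> C') \<Gamma>" by simp
  then show ?case by blast
qed

lemma ex_context:
  assumes "valid w t" "nseq_of (subtree w t) = \<Delta> + \<Gamma>"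
  obtains C where "nseq_of t = fill C \<Gamma>"
    "\<And>g \<Gamma>'. nseq_of (g (subtree w t)) = \<Delta> + \<Gamma>' \<Longrightarrow> nseq_of (update g w t) = fill C \<Gamma>'"
proof -
  obtain C where C: "\<And>g. nseq_of (update g w t) = fill C (nseq_of (g (subtree w t)))"
    using ex_context_update[OF assms(1)] by blast
  obtain C' where C': "\<And>\<Gamma>. fill C (\<Delta> + \<Gamma>) = fill C' \<Gamma>"
    using ex_context_absorb by blast
  show ?thesis
    using that[of C'] C[of "\<lambda>s. s"] C assms C' update_id[OF assms(1)] by simp
qed

text \<open>The lists \<open>\<Delta>s\<close> collect what lies beside the path \<open>u\<close>.
  They are shared by both equations, which thus have the shape of conclusion and premise of
  \<open>dia_k_rule\<close>; the formulas at the start of the path stay in \<open>\<Delta>\<close>,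
  where the diamond is found.\<close>

lemma ex_nest:
  assumes "valid u t"
  shows "\<exists>\<Delta> \<Delta>s. length \<Delta>s = length u \<and> (u \<noteq> [] \<longrightarrow> image_mset Fm (fms t) \<subseteq># \<Delta>) \<and>
    nseq_of t = \<Delta> + nest \<Delta>s {#} \<and> nseq_of (update (add_fm A) u t) = \<Delta> + nest \<Delta>s {#Fm A#}"
  using assms
proof (induction u arbitrary: t)
  case Nil
  have "nseq_of (update (add_fm A) [] t) = nseq_of t + {#Fm A#}"
    by (simp add: add_fm_def nseq_of_Node[of t])
  then show ?case by (intro exI[of _ "nseq_of t"] exI[of _ "[]"]) simp
next
  case (Cons i u)
  then have i: "i < length (kids t)" by simp
  obtain \<Delta> \<Delta>s where IH: "length \<Delta>s = length u"
    "nseq_of (kids t ! i) = \<Delta> + nest \<Delta>s {#}"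
    "nseq_of (update (add_fm A) u (kids t ! i)) = \<Delta> + nest \<Delta>s {#Fm A#}"
    using Cons.IH[of "kids t ! i"] Cons.prems by auto
  let ?\<Theta> = "image_mset Fm (fms t) + (mset (map (\<lambda>s. Bracket (nseq_of s)) (kids t)) -
    {#Bracket (nseq_of (kids t ! i))#})"
  have "nseq_of t = ?\<Theta> + nest (\<Delta> # \<Delta>s) {#}"
    using nseq_of_child[OF i, of "fms t" "kids t ! i"]
    by (simp only: list_update_id tree.collapse IH(2) nest.simps)
  moreover have "nseq_of (update (add_fm A) (i # u) t) = ?\<Theta> + nest (\<Delta> # \<Delta>s) {#Fm A#}"
    using nseq_of_child[OF i, of "fms t" "update (add_fm A) u (kids t ! i)"]
    by (simp only: update.simps IH(3) nest.simps)
  ultimately show ?case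
    using IH(1) by (intro exI[of _ ?\<Theta>] exI[of _ "\<Delta> # \<Delta>s"] conjI) simp_all
qed

section \<open>One step of proof search\<close>

text \<open>The trace left by a formula consumed by its rule. The value False for literals and
  diamonds expresses that they are never consumed.\<close>

primrec reduced :: "'a fm \<Rightarrow> 'a tree \<Rightarrow> bool" where
  "reduced (Pos p) t \<longleftrightarrow> False"
| "reduced (Neg p) t \<longleftrightarrow> False"
| "reduced (And A B) t \<longleftrightarrow> A \<in># fms t \<or> B \<in># fms t"
| "reduced (Or A B) t \<longleftrightarrow> A \<in># fms t \<and> B \<in># fms t"
| "reduced (Box A) t \<longleftrightarrow> (\<exists>i<length (kids t). A \<in># fms (kids t ! i))"
| "reduced (Dia A) t \<longleftrightarrow> False"

primrec reducible :: "'a fm \<Rightarrow> bool" where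
  "reducible (Pos p) \<longleftrightarrow> False"
| "reducible (Neg p) \<longleftrightarrow> False"
| "reducible (And A B) \<longleftrightarrow> True"
| "reducible (Or A B) \<longleftrightarrow> True"
| "reducible (Box A) \<longleftrightarrow> True"
| "reducible (Dia A) \<longleftrightarrow> False"

lemma reduced_reducible: "reduced A t \<Longrightarrow> reducible A"
  by (cases A) auto

text \<open>Meant for two consecutive stages: it need not be transitive, since the components left
  by a reduction may themselves be consumed later.\<close>

definition extends :: "'a tree \<Rightarrow> 'a tree \<Rightarrow> bool" where
  "extends t t' \<longleftrightarrow> (\<forall>w. valid w t \<longrightarrow> valid w t' \<and>
    (\<forall>A. A \<in># fms (subtree w t) \<longrightarrow> A \<in># fms (subtree w t') \<or> reduced A (subtree w t')))"

lemma extends_refl: "extends t t"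
  by (simp add: extends_def)

text \<open>New children go to the end of the list, so existing addresses keep their meaning, and
  only the formulas at the root change.\<close>

lemma extends_local:
  assumes "\<And>A. A \<in># fms t \<Longrightarrow> A \<in># \<Phi> \<or> reduced A (Node \<Phi> (kids t @ ts))"
  shows "extends t (Node \<Phi> (kids t @ ts))"
  unfolding extends_def
proof (intro allI impI)
  fix w assume "valid w t"
  then show "valid w (Node \<Phi> (kids t @ ts)) \<and> (\<forall>A. A \<in># fms (subtree w t) \<longrightarrow>
    A \<in># fms (subtree w (Node \<Phi> (kids t @ ts))) \<or> reduced A (subtree w (Node \<Phi> (kids t @ ts))))"
    using assms by (cases w) (auto simp: nth_append)
qed

lemma extends_update:
  assumes "valid w t" "extends (subtree w t) (g (subtree w t))"
  shows "extends t (update g w t)"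
  using assms
proof (induction w arbitrary: t)
  case Nil
  then show ?case by simp
next
  case (Cons i w)
  then have IH: "extends (kids t ! i) (update g w (kids t ! i))" by simp
  show ?case
    unfolding extends_def
  proof (intro allI impI)
    fix v assume v: "valid v t"
    show "valid v (update g (i # w) t) \<and> (\<forall>A. A \<in># fms (subtree v t) \<longrightarrow>
      A \<in># fms (subtree v (update g (i # w) t)) \<or> reduced A (subtree v (update g (i # w) t)))"
    proof (cases v)
      case Nil
      then show ?thesis by simp
    next
      case (Cons j v')
      then show ?thesis
        using v IH by (cases "j = i") (auto simp: extends_def)
    qed
  qed
qed

lemma valid_append: "valid (w @ u) t \<longleftrightarrow> valid w t \<and> valid u (subtree w t)"
  by (induction w arbitrary: t) auto

lemma subtree_append: "subtree (w @ u) t = subtree u (subtree w t)"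
  by (induction w arbitrary: t) auto

lemma subtree_update: "valid w t \<Longrightarrow> subtree w (update g w t) = g (subtree w t)"
  by (induction w arbitrary: t) auto

section \<open>Passing unprovability from a conclusion to a premise\<close>

definition cutfree :: "nat set \<Rightarrow> 'a rule" where
  "cutfree Y = nK \<union> dia_k_rules Y"

lemma unprovable_premise:
  assumes "(\<Gamma>s, \<Gamma>) \<in> N" "\<not> N \<turnstile> \<Gamma>"
  obtains \<Delta> where "\<Delta> \<in> set \<Gamma>s" "\<not> N \<turnstile> \<Delta>"
  using assms provable.step by metis

lemma reduce_step:
  fixes t :: "'a tree"
  assumes "\<not> cutfree Y \<turnstile> nseq_of t" "valid w t" "A \<in># fms (subtree w t)" "reducible A"
  shows "\<exists>t'. \<not> cutfree Y \<turnstile> nseq_of t' \<and> extends t t' \<and> reduced A (subtree w t')"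
proof -
  let ?s = "subtree w t"
  obtain \<Phi> where \<Phi>: "fms ?s = add_mset A \<Phi>" using assms(3) by (meson multi_member_split)
  define \<Delta> :: "'a nseq"
    where "\<Delta> = image_mset Fm \<Phi> + mset (map (\<lambda>s. Bracket (nseq_of s)) (kids ?s))"
  have "nseq_of ?s = \<Delta> + {#Fm A#}" by (simp add: nseq_of_Node[of ?s] \<Phi> \<Delta>_def)
  then obtain C where C: "nseq_of t = fill C {#Fm A#}"
    "\<And>g \<Gamma>'. nseq_of (g ?s) = \<Delta> + \<Gamma>' \<Longrightarrow> nseq_of (update g w t) = fill C \<Gamma>'"
    using ex_context[OF assms(2)] by metis
  \<comment> \<open>All three rules replace one occurrence of \<open>A\<close> by formulas
    \<open>\<Psi>\<close> and fresh children \<open>ts\<close>, so an unprovable premise of this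
    shape suffices.\<close>
  have suff: ?thesis
    if "\<not> cutfree Y \<turnstile> fill C (image_mset Fm \<Psi> + mset (map (\<lambda>s. Bracket (nseq_of s)) ts))"
      "reduced A (Node (\<Phi> + \<Psi>) (kids ?s @ ts))" for \<Psi> ts
  proof (intro exI conjI)
    let ?g = "\<lambda>_. Node (\<Phi> + \<Psi>) (kids ?s @ ts)"
    have "nseq_of (?g ?s) = \<Delta> + (image_mset Fm \<Psi> + mset (map (\<lambda>s. Bracket (nseq_of s)) ts))"
      by (simp add: \<Delta>_def)
    from C(2)[of ?g, OF this] that(1) show "\<not> cutfree Y \<turnstile> nseq_of (update ?g w t)" by simp
    show "extends t (update ?g w t)"
      using that(2) \<Phi> by (intro extends_update[OF assms(2)] extends_local) auto
    show "reduced A (subtree w (update ?g w t))"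
      using that(2) by (simp add: subtree_update[OF assms(2)])
  qed
  show ?thesis
  proof (cases A)
    case (And B D)
    then have "([fill C {#Fm B#}, fill C {#Fm D#}], nseq_of t) \<in> cutfree Y"
      by (auto simp: C(1) cutfree_def nK_def and_rule_def)
    then have "\<not> cutfree Y \<turnstile> fill C {#Fm B#} \<or> \<not> cutfree Y \<turnstile> fill C {#Fm D#}"
      using assms(1) by (elim unprovable_premise) auto
    with And suff[of "{#B#}" "[]"] suff[of "{#D#}" "[]"] show ?thesis by auto
  next
    case (Or B D)
    then have "([fill C {#Fm B, Fm D#}], nseq_of t) \<in> cutfree Y"
      by (auto simp: C(1) cutfree_def nK_def or_rule_def)
    then have "\<not> cutfree Y \<turnstile> fill C {#Fm B, Fm D#}"
      using assms(1) by (elim unprovable_premise) auto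
    with Or suff[of "{#B, D#}" "[]"] show ?thesis by auto
  next
    case (Box B)
    then have "([fill C {#Bracket {#Fm B#}#}], nseq_of t) \<in> cutfree Y"
      by (auto simp: C(1) cutfree_def nK_def box_rule_def)
    then have "\<not> cutfree Y \<turnstile> fill C {#Bracket {#Fm B#}#}"
      using assms(1) by (elim unprovable_premise) auto
    moreover have "reduced A (Node \<Phi> (kids ?s @ [Node {#B#} []]))"
      using Box by (auto intro!: exI[of _ "length (kids ?s)"])
    ultimately show ?thesis using suff[of "{#}" "[Node {#B#} []]"] by auto
  qed (use assms(4) in auto)
qed

text \<open>The rule keeps \<open>Dia A\<close> and adds \<open>A\<close> at the end of the path
  \<open>u\<close>, whose length selects the rule: \<open>dia_rule\<close> for 1,
  \<open>dia_k_rule\<close> for the members of \<open>Y\<close>.\<close>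

lemma propagate_step:
  assumes "\<not> cutfree Y \<turnstile> nseq_of t" "valid (w @ u) t" "Dia A \<in># fms (subtree w t)"
    and "u \<noteq> []" "length u \<in> insert 1 Y"
  shows "\<exists>t'. \<not> cutfree Y \<turnstile> nseq_of t' \<and> extends t t' \<and> valid (w @ u) t' \<and>
    A \<in># fms (subtree (w @ u) t')"
proof -
  let ?s = "subtree w t" and ?g = "update (add_fm A) u"
  have w: "valid w t" and u: "valid u ?s" using assms(2) by (simp_all add: valid_append)
  obtain \<Delta> \<Delta>s where \<Delta>: "length \<Delta>s = length u" "image_mset Fm (fms ?s) \<subseteq># \<Delta>"
    "nseq_of ?s = \<Delta> + nest \<Delta>s {#}" "nseq_of (?g ?s) = \<Delta> + nest \<Delta>s {#Fm A#}"
    using ex_nest[OF u, of A] assms(4) by blast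
  have "Fm (Dia A) \<in># \<Delta>"
    using assms(3) \<Delta>(2) by (meson image_eqI in_image_mset mset_subset_eqD)
  then obtain \<Delta>' where \<Delta>': "\<Delta> = add_mset (Fm (Dia A)) \<Delta>'" by (meson multi_member_split)
  have s: "nseq_of ?s = \<Delta>' + ({#Fm (Dia A)#} + nest \<Delta>s {#})"
    "nseq_of (?g ?s) = \<Delta>' + ({#Fm (Dia A)#} + nest \<Delta>s {#Fm A#})"
    using \<Delta>(3,4) \<Delta>' by simp_all
  obtain C where C: "nseq_of t = fill C ({#Fm (Dia A)#} + nest \<Delta>s {#})"
    "nseq_of (update ?g w t) = fill C ({#Fm (Dia A)#} + nest \<Delta>s {#Fm A#})"
    using ex_context[OF w s(1)] s(2) by metis
  have "([nseq_of (update ?g w t)], nseq_of t) \<in> cutfree Y"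
  proof (cases "length u = 1")
    case True
    then obtain \<Theta> where "\<Delta>s = [\<Theta>]" using \<Delta>(1) by (metis One_nat_def length_0_conv length_Suc_conv)
    then show ?thesis
      unfolding C cutfree_def nK_def dia_rule_def by (auto simp: add_mset_commute)
  next
    case False
    then have "length u \<in> Y" "length u \<ge> 1" using assms(4,5) by (auto simp: Suc_le_eq)
    then show ?thesis
      unfolding C cutfree_def dia_k_rules_def dia_k_rule_def using \<Delta>(1) by blast
  qed
  then have "\<not> cutfree Y \<turnstile> nseq_of (update ?g w t)"
    using assms(1) by (elim unprovable_premise) auto
  moreover have "extends t (update ?g w t)"
  proof (intro extends_update w u)
    show "extends (subtree u ?s) (add_fm A (subtree u ?s))"
      using extends_local[of "subtree u ?s" "add_mset A (fms (subtree u ?s))" "[]"]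
      by (simp add: add_fm_def)
  qed
  moreover have "A \<in># fms (subtree (w @ u) (update ?g w t))"
    by (simp add: subtree_append subtree_update w u add_fm_def)
  ultimately show ?thesis using assms(2) by (metis extends_def)
qed

text \<open>A task is a triple of \<open>w\<close>, \<open>A\<close> and \<open>u\<close>. At most
  one of its two parts applies, since a diamond is not reducible; if none applies, the tree is left
  unchanged.\<close>

lemma search_step:
  assumes "\<not> cutfree Y \<turnstile> nseq_of t"
  shows "\<exists>t'. \<not> cutfree Y \<turnstile> nseq_of t' \<and> extends t t' \<and>
    (valid w t \<longrightarrow> A \<in># fms (subtree w t) \<longrightarrow> reducible A \<longrightarrow> reduced A (subtree w t')) \<and>
    (\<forall>B. A = Dia B \<longrightarrow> A \<in># fms (subtree w t) \<longrightarrow> valid (w @ u) t \<longrightarrow> u \<noteq> [] \<longrightarrow>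
      length u \<in> insert 1 Y \<longrightarrow> valid (w @ u) t' \<and> B \<in># fms (subtree (w @ u) t'))"
proof (cases "reducible A \<and> valid w t \<and> A \<in># fms (subtree w t)")
  case True
  then obtain t' where "\<not> cutfree Y \<turnstile> nseq_of t'" "extends t t'" "reduced A (subtree w t')"
    using reduce_step[OF assms] by blast
  with True show ?thesis by (intro exI[of _ t']) auto
next
  case irreducible: False
  show ?thesis
  proof (cases "\<exists>B. A = Dia B \<and> A \<in># fms (subtree w t) \<and> valid (w @ u) t \<and> u \<noteq> [] \<and>
      length u \<in> insert 1 Y")
    case True
    then obtain B where B: "A = Dia B" "Dia B \<in># fms (subtree w t)" "valid (w @ u) t" "u \<noteq> []"
      "length u \<in> insert 1 Y" by blast
    then obtain t' where "\<not> cutfree Y \<turnstile> nseq_of t'" "extends t t'" "valid (w @ u) t'"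
      "B \<in># fms (subtree (w @ u) t')"
      using propagate_step[OF assms] by blast
    with B(1) show ?thesis by (intro exI[of _ t']) auto
  next
    case False
    then show ?thesis using assms extends_refl irreducible by (intro exI[of _ t]) blast
  qed
qed

section \<open>The limit of a fair search\<close>

lemma ex_fair_search:
  fixes t :: "'a::countable tree"
  assumes "\<not> cutfree Y \<turnstile> nseq_of t"
  obtains f where "f 0 = t" "\<And>n. \<not> cutfree Y \<turnstile> nseq_of (f n)" "\<And>n. extends (f n) (f (Suc n))"
    "\<And>w A n. reducible A \<Longrightarrow> \<exists>k\<ge>n. valid w (f k) \<longrightarrow> A \<in># fms (subtree w (f k)) \<longrightarrow>
      reduced A (subtree w (f (Suc k)))"
    "\<And>w u B n. u \<noteq> [] \<Longrightarrow> length u \<in> insert 1 Y \<Longrightarrow>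
      \<exists>k\<ge>n. Dia B \<in># fms (subtree w (f k)) \<longrightarrow> valid (w @ u) (f k) \<longrightarrow>
        valid (w @ u) (f (Suc k)) \<and> B \<in># fms (subtree (w @ u) (f (Suc k)))"
proof -
  \<comment> \<open>The first component of the decoded pair codes a task, the second is a free
    counter, so every task recurs at arbitrarily late stages. Countability of the formulas makes
    tasks codable.\<close>
  define task :: "nat \<Rightarrow> nat list \<times> 'a fm \<times> nat list"
    where "task n = from_nat (fst (prod_decode n))" for n
  have task: "\<exists>k\<ge>n. task k = x" for n x
    by (rule exI[of _ "prod_encode (to_nat x, n)"]) (simp add: task_def le_prod_encode_2)
  define Q where "Q n t t' \<longleftrightarrow> (case task n of (w, A, u) \<Rightarrow>
    extends t t' \<and>
    (valid w t \<longrightarrow> A \<in># fms (subtree w t) \<longrightarrow> reducible A \<longrightarrow> reduced A (subtree w t')) \<and>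
    (\<forall>B. A = Dia B \<longrightarrow> A \<in># fms (subtree w t) \<longrightarrow> valid (w @ u) t \<longrightarrow> u \<noteq> [] \<longrightarrow>
      length u \<in> insert 1 Y \<longrightarrow> valid (w @ u) t' \<and> B \<in># fms (subtree (w @ u) t')))"
    for n t t'
  have "\<exists>f. \<forall>n. (\<not> cutfree Y \<turnstile> nseq_of (f n) \<and> (n = 0 \<longrightarrow> f n = t)) \<and> Q n (f n) (f (Suc n))"
  proof (rule dependent_nat_choice)
    show "\<exists>x. \<not> cutfree Y \<turnstile> nseq_of x \<and> (0 = (0::nat) \<longrightarrow> x = t)" using assms by blast
    fix x :: "'a tree" and n :: nat
    assume x: "\<not> cutfree Y \<turnstile> nseq_of x \<and> (n = 0 \<longrightarrow> x = t)"
    obtain w A u where "task n = (w, A, u)" by (metis prod_cases3)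
    with search_step[of Y x w A u] x
    show "\<exists>y. (\<not> cutfree Y \<turnstile> nseq_of y \<and> (Suc n = 0 \<longrightarrow> y = t)) \<and> Q n x y"
      by (simp add: Q_def)
  qed
  then obtain f where f: "\<And>n. \<not> cutfree Y \<turnstile> nseq_of (f n)" "f 0 = t" "\<And>n. Q n (f n) (f (Suc n))"
    by blast
  show ?thesis
  proof (rule that[of f])
    show "extends (f n) (f (Suc n))" for n
      using f(3)[of n] by (auto simp: Q_def split: prod.splits)
    show "\<exists>k\<ge>n. valid w (f k) \<longrightarrow> A \<in># fms (subtree w (f k)) \<longrightarrow>
      reduced A (subtree w (f (Suc k)))" if "reducible A" for w A n
    proof -
      obtain k where "k \<ge> n" "task k = (w, A, [])" using task by blast
      with f(3)[of k] that show ?thesis by (auto simp: Q_def)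
    qed
    show "\<exists>k\<ge>n. Dia B \<in># fms (subtree w (f k)) \<longrightarrow> valid (w @ u) (f k) \<longrightarrow>
        valid (w @ u) (f (Suc k)) \<and> B \<in># fms (subtree (w @ u) (f (Suc k)))"
      if "u \<noteq> []" "length u \<in> insert 1 Y" for w u B n
    proof -
      obtain k where "k \<ge> n" "task k = (w, Dia B, u)" using task by blast
      with f(3)[of k] that show ?thesis by (auto simp: Q_def)
    qed
  qed (use f in auto)
qed

lemma fill_id_provable: "cutfree Y \<turnstile> fill C {#Fm (Pos p), Fm (Neg p)#}"
  by (rule provable.step[of "[]"]) (auto simp: cutfree_def nK_def id_rule_def)

lemma not_clash:
  assumes "\<not> cutfree Y \<turnstile> nseq_of t" "valid w t"
    and "Pos p \<in># fms (subtree w t)" "Neg p \<in># fms (subtree w t)"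
  shows False
proof -
  obtain \<Phi> where "fms (subtree w t) = add_mset (Pos p) (add_mset (Neg p) \<Phi>)"
    using assms(3,4) by (metis fm.distinct(1) insert_noteq_member multi_member_split)
  then have "nseq_of (subtree w t) =
    (image_mset Fm \<Phi> + mset (map (\<lambda>s. Bracket (nseq_of s)) (kids (subtree w t)))) +
    {#Fm (Pos p), Fm (Neg p)#}"
    by (simp add: nseq_of_Node[of "subtree w t"])
  then show False using ex_context[OF assms(2)] assms(1) fill_id_provable by metis
qed

text \<open>\<open>D\<close> and \<open>T\<close> gather the nodes and formulas occurring at any
  stage. A consumed formula thus remains in \<open>T\<close>, together with the components left by
  its reduction.\<close>

lemma ex_hintikka_tree:
  fixes t :: "'a::countable tree"
  assumes "\<not> cutfree Y \<turnstile> nseq_of t"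
  obtains D :: "nat list set" and T :: "nat list \<Rightarrow> 'a fm set"
  where "\<And>w. valid w t \<Longrightarrow> w \<in> D" "\<And>w A. valid w t \<Longrightarrow> A \<in># fms (subtree w t) \<Longrightarrow> A \<in> T w"
    "\<And>w p. Pos p \<in> T w \<Longrightarrow> Neg p \<notin> T w"
    "\<And>w A B. And A B \<in> T w \<Longrightarrow> A \<in> T w \<or> B \<in> T w"
    "\<And>w A B. Or A B \<in> T w \<Longrightarrow> A \<in> T w \<and> B \<in> T w"
    "\<And>w A. Box A \<in> T w \<Longrightarrow> \<exists>i. w @ [i] \<in> D \<and> A \<in> T (w @ [i])"
    "\<And>w u A. Dia A \<in> T w \<Longrightarrow> w @ u \<in> D \<Longrightarrow> u \<noteq> [] \<Longrightarrow> length u \<in> insert 1 Y \<Longrightarrow> A \<in> T (w @ u)"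
proof -
  obtain f where f0: "f 0 = t" and unprov: "\<And>n. \<not> cutfree Y \<turnstile> nseq_of (f n)"
    and ext: "\<And>n. extends (f n) (f (Suc n))"
    and red: "\<And>w A n. reducible A \<Longrightarrow> \<exists>k\<ge>n. valid w (f k) \<longrightarrow> A \<in># fms (subtree w (f k)) \<longrightarrow>
      reduced A (subtree w (f (Suc k)))"
    and dia: "\<And>w u B n. u \<noteq> [] \<Longrightarrow> length u \<in> insert 1 Y \<Longrightarrow>
      \<exists>k\<ge>n. Dia B \<in># fms (subtree w (f k)) \<longrightarrow> valid (w @ u) (f k) \<longrightarrow>
        valid (w @ u) (f (Suc k)) \<and> B \<in># fms (subtree (w @ u) (f (Suc k)))"
    using ex_fair_search[OF assms] by blast
  define D where "D = {w. \<exists>n. valid w (f n)}"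
  define T where "T w = {A. \<exists>n. valid w (f n) \<and> A \<in># fms (subtree w (f n))}" for w
  have valid_mono: "valid w (f n)" if "valid w (f m)" "m \<le> n" for w m n
    using that(2,1) by (induction rule: dec_induct) (use ext in \<open>auto simp: extends_def\<close>)
  \<comment> \<open>The second alternative speaks of some stage, not of stage \<open>n\<close>,
    because the components of \<open>A\<close> may have been consumed in the meantime.\<close>
  have persist: "A \<in># fms (subtree w (f n)) \<or> (\<exists>k. valid w (f k) \<and> reduced A (subtree w (f k)))"
    if "valid w (f m)" "A \<in># fms (subtree w (f m))" "m \<le> n" for w A m n
    using that(3)
  proof (induction rule: dec_induct)
    case base
    then show ?case using that by blast
  next
    case (step n)
    then show ?case
      using ext[of n] valid_mono[OF that(1) step.hyps(1)] unfolding extends_def by blast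
  qed
  have static: "A \<in># fms (subtree w (f n))"
    if "valid w (f m)" "A \<in># fms (subtree w (f m))" "m \<le> n" "\<not> reducible A" for w A m n
    using persist[OF that(1-3)] that(4) reduced_reducible by blast
  have reduced: "\<exists>k. valid w (f k) \<and> reduced A (subtree w (f k))"
    if A: "A \<in> T w" "reducible A" for w A
  proof -
    obtain n where n: "valid w (f n)" "A \<in># fms (subtree w (f n))" using A by (auto simp: T_def)
    obtain k where "k \<ge> n" "valid w (f k) \<longrightarrow> A \<in># fms (subtree w (f k)) \<longrightarrow>
      reduced A (subtree w (f (Suc k)))" using red[OF A(2)] by blast
    \<comment> \<open>If \<open>A\<close> is still present at stage \<open>k\<close>, the scheduled
      task reduces it; otherwise \<open>persist\<close> supplies a stage where it is
      reduced.\<close>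
    then show ?thesis using persist[OF n, of k] valid_mono[OF n(1)] by (meson le_Suc_eq)
  qed
  show ?thesis
  proof (rule that[of D T])
    show "w \<in> D" if "valid w t" for w using that f0 by (auto simp: D_def)
    show "A \<in> T w" if "valid w t" "A \<in># fms (subtree w t)" for w A
      using that f0 by (auto simp: T_def)
    show "Neg p \<notin> T w" if "Pos p \<in> T w" for w p
    proof
      assume "Neg p \<in> T w"
      with that obtain m n where mn: "valid w (f m)" "Pos p \<in># fms (subtree w (f m))"
        "valid w (f n)" "Neg p \<in># fms (subtree w (f n))" by (auto simp: T_def)
      \<comment> \<open>Literals are never consumed, so both are present at a common stage, whose
        sequent would be an axiom.\<close>
      let ?k = "max m n"
      have "Pos p \<in># fms (subtree w (f ?k))" "Neg p \<in># fms (subtree w (f ?k))"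
        using mn by (auto intro: static)
      with not_clash[OF unprov[of ?k]] valid_mono[OF mn(1), of ?k] show False by simp
    qed
    show "A \<in> T w \<or> B \<in> T w" if "And A B \<in> T w" for w A B
      using reduced[OF that] by (auto simp: T_def)
    show "A \<in> T w \<and> B \<in> T w" if "Or A B \<in> T w" for w A B
      using reduced[OF that] by (auto simp: T_def)
    show "\<exists>i. w @ [i] \<in> D \<and> A \<in> T (w @ [i])" if box: "Box A \<in> T w" for w A
    proof -
      obtain k i where "valid w (f k)" "i < length (kids (subtree w (f k)))"
        "A \<in># fms (kids (subtree w (f k)) ! i)" using reduced[OF box] by auto
      then have "valid (w @ [i]) (f k)" "A \<in># fms (subtree (w @ [i]) (f k))"
        by (simp_all add: valid_append subtree_append)
      then show ?thesis by (auto simp: D_def T_def)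
    qed
    show "A \<in> T (w @ u)"
      if "Dia A \<in> T w" "w @ u \<in> D" "u \<noteq> []" "length u \<in> insert 1 Y" for w u A
    proof -
      obtain m n where mn: "valid w (f m)" "Dia A \<in># fms (subtree w (f m))" "valid (w @ u) (f n)"
        using \<open>Dia A \<in> T w\<close> \<open>w @ u \<in> D\<close> by (auto simp: T_def D_def)
      \<comment> \<open>The node \<open>w @ u\<close> may arise long after \<open>Dia A\<close> was
        first treated; recurrence of tasks gives a treatment after both are present.\<close>
      obtain k where k: "k \<ge> max m n" "Dia A \<in># fms (subtree w (f k)) \<longrightarrow> valid (w @ u) (f k) \<longrightarrow>
        valid (w @ u) (f (Suc k)) \<and> A \<in># fms (subtree (w @ u) (f (Suc k)))"
        using dia[OF \<open>u \<noteq> []\<close> \<open>length u \<in> insert 1 Y\<close>] by blast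
      then have "Dia A \<in># fms (subtree w (f k))" "valid (w @ u) (f k)"
        using static[OF mn(1,2), of k] valid_mono[OF mn(3), of k] by auto
      with k(2) show ?thesis by (auto simp: T_def)
    qed
  qed
qed

section \<open>The completion and the countermodel\<close>

text \<open>Stages increase, so both numbers lie in a common stage and the next one adds
  \<open>m + n - 1\<close>.\<close>

lemma completion_closed:
  assumes "m \<in> completion X" "n \<in> completion X"
  shows "m + n - 1 \<in> completion X"
proof -
  obtain p q where pq: "m \<in> completion_stage X p" "n \<in> completion_stage X q"
    using assms by (auto simp: completion_def)
  have mono: "completion_stage X i \<subseteq> completion_stage X j" if "i \<le> j" for i j
    using that by (induction rule: dec_induct) auto
  have "m + n - 1 \<in> completion_stage X (Suc (max p q))"
    using pq mono[of p "max p q"] mono[of q "max p q"] by fastforce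
  then show ?thesis unfolding completion_def by blast
qed

lemma completion_gt_1:
  assumes "X \<subseteq> {n. n > 1}" "n \<in> completion X"
  shows "n > 1"
proof -
  have "completion_stage X p \<subseteq> {n. n > 1}" for p
  proof (induction p)
    case (Suc p)
    have "m + n - 1 > 1" if "m \<in> completion_stage X p" "n \<in> completion_stage X p" for m n
      using subsetD[OF Suc that(1)] subsetD[OF Suc that(2)] by simp
    with Suc show ?case by auto
  qed (use assms(1) in simp)
  then show ?thesis using assms(2) unfolding completion_def by blast
qed

definition descendant :: "nat set \<Rightarrow> nat list set \<Rightarrow> nat list \<Rightarrow> nat list \<Rightarrow> bool" where
  "descendant Y D w v \<longleftrightarrow> (\<exists>u. v = w @ u \<and> length u \<in> insert 1 Y \<and> v \<in> D)"

lemma descendant_child: "w @ [i] \<in> D \<Longrightarrow> descendant Y D w (w @ [i])"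
  by (simp add: descendant_def)

text \<open>A step of length \<open>l\<close> has excess \<open>l - 1\<close>, and adding this
  excess maps \<open>Y\<close> into itself: trivially for \<open>l = 1\<close>, by closure for
  \<open>l\<close> in \<open>Y\<close>. The total excess of \<open>k\<close> steps is
  \<open>length u - k\<close>, so adding it also maps \<open>Y\<close> into itself.\<close>

lemma relpowp_descendant:
  assumes closed: "\<And>m n. m \<in> Y \<Longrightarrow> n \<in> Y \<Longrightarrow> m + n - 1 \<in> Y" and pos: "\<And>n. n \<in> Y \<Longrightarrow> n > 1"
    and "(descendant Y D ^^ k) w v"
  shows "\<exists>u. v = w @ u \<and> k \<le> length u \<and> (\<forall>n\<in>Y. n + (length u - k) \<in> Y) \<and> (k > 0 \<longrightarrow> v \<in> D)"
  using assms(3)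
proof (induction k arbitrary: v)
  case 0
  then show ?case by simp
next
  case (Suc k)
  then obtain x where x: "(descendant Y D ^^ k) w x" "descendant Y D x v" by auto
  then obtain u where u: "x = w @ u" "k \<le> length u" "\<forall>n\<in>Y. n + (length u - k) \<in> Y"
    using Suc.IH by blast
  obtain u' where u': "v = x @ u'" "length u' \<in> insert 1 Y" "v \<in> D"
    using x(2) by (auto simp: descendant_def)
  have "length u' \<ge> 1" using u'(2) pos by fastforce
  have "n + (length (u @ u') - Suc k) \<in> Y" if "n \<in> Y" for n
  proof -
    \<comment> \<open>For a last step of length 1 this is the number from the induction hypothesis;
      otherwise closure applies.\<close>
    have "n + (length u - k) + length u' - 1 \<in> Y"
      using u'(2) u(3) that closed[of "n + (length u - k)" "length u'"] by auto
    moreover have "n + (length (u @ u') - Suc k) = n + (length u - k) + length u' - 1"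
      using \<open>length u' \<ge> 1\<close> u(2) by simp
    ultimately show ?thesis by simp
  qed
  with u u' \<open>length u' \<ge> 1\<close> show ?case by (intro exI[of _ "u @ u'"]) auto
qed

lemma completeness:
  fixes \<Gamma> :: "'a::countable nseq"
  assumes "\<not> cutfree Y \<turnstile> \<Gamma>" and pos: "\<And>n. n \<in> Y \<Longrightarrow> n > 1"
  shows "\<exists>D V. falsified (descendant Y D) V [] \<Gamma>"
proof -
  obtain t where t: "nseq_of t = \<Gamma>" using ex_tree by blast
  with assms obtain D T where
    D: "\<And>w. valid w t \<Longrightarrow> w \<in> D" and T: "\<And>w A. valid w t \<Longrightarrow> A \<in># fms (subtree w t) \<Longrightarrow> A \<in> T w"
    and hPos: "\<And>w p. Pos p \<in> T w \<Longrightarrow> Neg p \<notin> T w"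
    and hAnd: "\<And>w A B. And A B \<in> T w \<Longrightarrow> A \<in> T w \<or> B \<in> T w"
    and hOr: "\<And>w A B. Or A B \<in> T w \<Longrightarrow> A \<in> T w \<and> B \<in> T w"
    and hBox: "\<And>w A. Box A \<in> T w \<Longrightarrow> \<exists>i. w @ [i] \<in> D \<and> A \<in> T (w @ [i])"
    and hDia: "\<And>w u A. Dia A \<in> T w \<Longrightarrow> w @ u \<in> D \<Longrightarrow> u \<noteq> [] \<Longrightarrow> length u \<in> insert 1 Y \<Longrightarrow>
      A \<in> T (w @ u)"
    using ex_hintikka_tree[of Y t] by blast
  let ?R = "descendant Y D"
  \<comment> \<open>This makes negative literals in \<open>T w\<close> false by definition; positive
    ones are false because \<open>T w\<close> contains no clash.\<close>
  define V where "V w p \<longleftrightarrow> Neg p \<in> T w" for w p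
  have false: "\<not> sat ?R V w A" if "A \<in> T w" for w A
    using that
  proof (induction A arbitrary: w)
    case (Box A)
    then obtain i where "w @ [i] \<in> D" "A \<in> T (w @ [i])" using hBox by blast
    with Box.IH[of "w @ [i]"] descendant_child[of w i D Y] show ?case by auto
  next
    case (Dia A)
    \<comment> \<open>Every successor of \<open>w\<close> is a node at a distance over which
      \<open>Dia A\<close> was propagated; it differs from \<open>w\<close> because \<open>Y\<close>
      excludes 0.\<close>
    have "A \<in> T v" if wv: "?R w v" for v
    proof -
      obtain u where "v = w @ u" "length u \<in> insert 1 Y" "v \<in> D"
        using wv unfolding descendant_def by blast
      moreover from this(2) have "u \<noteq> []" using pos[of "length u"] by auto
      ultimately show ?thesis using hDia[OF Dia.prems] by blast
    qed
    with Dia.IH show ?case by auto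
  next
    case (Pos p)
    with hPos show ?case unfolding V_def by simp
  next
    case (Neg p)
    then show ?case unfolding V_def by simp
  next
    case (And A B)
    then show ?case using hAnd[OF And.prems] by auto
  next
    case (Or A B)
    then show ?case using hOr[OF Or.prems] by auto
  qed
  \<comment> \<open>The starting tree is read at its own addresses: the child at index
    \<open>i\<close> is the world witnessing its bracket.\<close>
  have "falsified ?R V w (nseq_of s)" if "valid w t" "s = subtree w t" for w s
    using that
  proof (induction s arbitrary: w)
    case (Node \<Phi> ts)
    note node = Node.prems(2)[symmetric]
    have "\<exists>v. ?R w v \<and> falsified ?R V v (nseq_of s)" if s: "s \<in> set ts" for s
    proof -
      obtain i where i: "i < length ts" "s = ts ! i" using s by (metis in_set_conv_nth)
      have child: "valid (w @ [i]) t" "s = subtree (w @ [i]) t"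
        using Node.prems(1) i by (simp_all add: valid_append subtree_append node)
      have "?R w (w @ [i])" using D[OF child(1)] by (rule descendant_child)
      with Node.IH[OF s child] show ?thesis by blast
    qed
    moreover have "\<not> sat ?R V w A" if "A \<in># \<Phi>" for A
      using false[OF T[OF Node.prems(1)]] that by (simp add: node)
    ultimately show ?case by (subst falsified_iff) auto
  qed
  from this[of "[]" t] t show ?thesis by auto
qed

theorem theorem17:
  fixes X :: "nat set" and \<Gamma> :: "'a::countable nseq"
  assumes "X \<subseteq> {n. n > 1}"
    and "nK \<union> dia_k_rules (completion X) \<union> cut_rule \<turnstile> \<Gamma>"
  shows "nK \<union> dia_k_rules (completion X) \<turnstile> \<Gamma>"
proof (rule ccontr)
  let ?Y = "completion X"
  note gt_1 = completion_gt_1[OF assms(1)]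
  assume "\<not> nK \<union> dia_k_rules ?Y \<turnstile> \<Gamma>"
  then obtain D V where fals: "falsified (descendant ?Y D) V [] \<Gamma>"
    using completeness[OF _ gt_1, of ?Y \<Gamma>] unfolding cutfree_def by blast
  have closed: "descendant ?Y D w v" if n: "n \<in> ?Y" "(descendant ?Y D ^^ n) w v" for n w v
  proof -
    obtain u where u: "v = w @ u" "n \<le> length u" "\<forall>m\<in>?Y. m + (length u - n) \<in> ?Y"
      "n > 0 \<longrightarrow> v \<in> D"
      using relpowp_descendant[OF completion_closed gt_1 n(2)] by blast
    \<comment> \<open>Shifting \<open>n\<close> itself by the excess gives \<open>length u\<close>,
      so the endpoint of the path is a descendant in one step.\<close>
    have "n + (length u - n) \<in> ?Y" using u(3) n(1) by blast
    with u gt_1[OF n(1)] show ?thesis unfolding descendant_def by simp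
  qed
  have "\<not> falsified (descendant ?Y D) V [] \<Gamma>"
    using assms(2) by (rule soundness) (rule closed)
  with fals show False by blast
qed

end
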